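(* Let $k$ be an odd positive integer. Then there exist infinitely many integers $r$ such that $\mathrm{bal}_r(n,P_{rk})=\Omega(n^2)$ (as $n\to\infty$). In particular, $\mathrm{bal}_7(n,P_{7k})=\Omega(n^2)$.
   Context: $P_m$ denotes the path with $m$ edges. An $r$-edge-colored graph $G$ is balanced if each of the $r$ colors appears on either $\lfloor e(G)/r\rfloor$ or $\lceil e(G)/r\rceil$ edges. For a graph $G$, $\mathrm{bal}_r(n,G)$ is the minimum integer $m$ (if it exists) such that every $r$-edge-coloring of $K_n$ with more than $m$ edges in each of the $r$ colors contains a balanced copy of $G$ (a subgraph isomorphic to $G$ whose inherited coloring is balanced); if no such $m$ exists, $\mathrm{bal}_r(n,G)=\infty$. *)

theory Defs
  imports Complex_Main "HOL-Library.Ramsey" "HOL-Library.Extended_Real"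
    "HOL-Library.Landau_Symbols"
begin

text \<open>A graph is a vertex set together with a set of two-element subsets of it.\<close>

type_synonym 'a graph = "'a set \<times> 'a set set"

abbreviation verts :: "'a graph \<Rightarrow> 'a set" where "verts \<equiv> fst"
abbreviation edges :: "'a graph \<Rightarrow> 'a set set" where "edges \<equiv> snd"

definition simple_graph :: "'a graph \<Rightarrow> bool" where
  "simple_graph G \<longleftrightarrow> finite (verts G) \<and> edges G \<subseteq> [verts G]\<^bsup>2\<^esup>"

definition subgraph :: "'a graph \<Rightarrow> 'a graph \<Rightarrow> bool" where
  "subgraph H G \<longleftrightarrow> simple_graph H \<and> verts H \<subseteq> verts G \<and> edges H \<subseteq> edges G"

definition graph_isomorphic :: "'a graph \<Rightarrow> 'b graph \<Rightarrow> bool" where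
  "graph_isomorphic G H \<longleftrightarrow>
     (\<exists>f. bij_betw f (verts G) (verts H) \<and> (\<lambda>e. f ` e) ` edges G = edges H)"

definition complete_graph :: "nat \<Rightarrow> nat graph" where
  "complete_graph n = ({..<n}, [{..<n}]\<^bsup>2\<^esup>)"

text \<open>The path is indexed by its number of edges, not of vertices.\<close>

definition path_graph :: "nat \<Rightarrow> nat graph" where
  "path_graph m = ({..m}, {{i, Suc i} |i. i < m})"

text \<open>Colours are the numbers below \<open>r\<close>; only the values of a colouring on edges matter.\<close>

definition edge_coloring :: "nat \<Rightarrow> 'a graph \<Rightarrow> ('a set \<Rightarrow> nat) \<Rightarrow> bool" where
  "edge_coloring r G c \<longleftrightarrow> c \<in> edges G \<rightarrow> {..<r}"

definition color_class :: "'a graph \<Rightarrow> ('a set \<Rightarrow> nat) \<Rightarrow> nat \<Rightarrow> 'a set set" where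
  "color_class G c i = {e \<in> edges G. c e = i}"

definition balanced :: "nat \<Rightarrow> 'a graph \<Rightarrow> ('a set \<Rightarrow> nat) \<Rightarrow> bool" where
  "balanced r G c \<longleftrightarrow>
     (\<forall>i<r. int (card (color_class G c i)) = \<lfloor>real (card (edges G)) / real r\<rfloor> \<or>
            int (card (color_class G c i)) = \<lceil>real (card (edges G)) / real r\<rceil>)"

definition has_balanced_copy ::
  "nat \<Rightarrow> 'a graph \<Rightarrow> ('a set \<Rightarrow> nat) \<Rightarrow> 'b graph \<Rightarrow> bool" where
  "has_balanced_copy r K c G \<longleftrightarrow>
     (\<exists>H. subgraph H K \<and> graph_isomorphic G H \<and> balanced r H c)"

text \<open>The infimum in \<^typ>\<open>enat\<close> is the minimum of a nonempty set, and \<open>\<infinity>\<close> for the empty one.\<close>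

definition bal :: "nat \<Rightarrow> nat \<Rightarrow> 'b graph \<Rightarrow> enat" where
  "bal r n G = Inf (enat ` {m. \<forall>c. edge_coloring r (complete_graph n) c \<longrightarrow>
       (\<forall>i<r. m < card (color_class (complete_graph n) c i)) \<longrightarrow>
       has_balanced_copy r (complete_graph n) c G})"

text \<open>The asymptotic lower bound \<open>f = \<Omega>(g)\<close> for a function that may take the value \<open>\<infinity>\<close>,
  which the library's Landau symbols do not cover.\<close>

definition enat_bigomega :: "(nat \<Rightarrow> enat) \<Rightarrow> (nat \<Rightarrow> real) \<Rightarrow> bool" where
  "enat_bigomega f g \<longleftrightarrow>
     (\<exists>C>0. \<forall>\<^sub>F n in sequentially. ereal (C * \<bar>g n\<bar>) \<le> ereal_of_enat (f n))"

lemma enat_bigomega_iff_bigomega: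
  "enat_bigomega (\<lambda>n. enat (f n)) g \<longleftrightarrow> (\<lambda>n. real (f n)) \<in> \<Omega>(g)"
  by (simp add: enat_bigomega_def bigomega_def)

lemma simple_graph_complete_graph: "simple_graph (complete_graph n)"
  by (simp add: simple_graph_def complete_graph_def)

lemma simple_graph_path_graph: "simple_graph (path_graph m)"
  by (auto simp: simple_graph_def path_graph_def nsets_def)

lemma card_edges_path_graph: "card (edges (path_graph m)) = m"
proof -
  have "edges (path_graph m) = (\<lambda>i. {i, Suc i}) ` {..<m}"
    by (auto simp: path_graph_def)
  moreover have "inj_on (\<lambda>i. {i, Suc i}) {..<m}"
    by (auto simp: inj_on_def doubleton_eq_iff)
  ultimately show ?thesis by (simp add: card_image)
qed

end

theory Submission
  imports Defs
begin

text \<open>Split the vertices of \<open>K\<^sub>n\<close> evenly into \<open>t\<close> parts, with \<open>t \<ge> 4\<close> even. Give each of the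
  \<open>t choose 2\<close> pairs of parts its own colour and use one further colour inside the parts, so that
  every colour class has quadratic size. In a balanced path of \<open>r * k\<close> edges every colour occurs
  exactly \<open>k\<close> times, so exactly \<open>(t - 1) * k\<close> edges leave a given part. This number is odd, hence
  each part contains exactly one endpoint of the path; but there are more than two parts.\<close>

definition edge_boundary :: "'a graph \<Rightarrow> 'a set \<Rightarrow> 'a set set" where
  "edge_boundary G A = {e \<in> edges G. e \<inter> A \<noteq> {} \<and> e - A \<noteq> {}}"

lemma finite_edges: "simple_graph G \<Longrightarrow> finite (edges G)"
  by (meson finite_imp_finite_nsets finite_subset simple_graph_def)

lemma inj_on_image_edges:
  assumes "simple_graph G" "inj_on f (verts G)"
  shows "inj_on (image f) (edges G)"
proof (rule inj_on_subset)
  show "inj_on (image f) (Pow (verts G))" using assms(2) by (rule inj_on_image_Pow)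
  show "edges G \<subseteq> Pow (verts G)" using assms(1) by (auto simp: simple_graph_def nsets_def)
qed

lemma graph_isomorphic_card_edges:
  assumes "simple_graph G" "graph_isomorphic G H"
  shows "card (edges H) = card (edges G)"
  using assms by (metis bij_betw_imp_inj_on card_image graph_isomorphic_def inj_on_image_edges)

lemma graph_isomorphic_card_edge_boundary:
  assumes "simple_graph G" "graph_isomorphic G H"
  obtains f where "\<And>A. card (edge_boundary H A) = card (edge_boundary G (f -` A))"
proof -
  from assms obtain f where bij: "bij_betw f (verts G) (verts H)"
    and edges: "image f ` edges G = edges H"
    by (auto simp: graph_isomorphic_def)
  have "inj_on (image f) (edges G)"
    using assms(1) bij by (simp add: bij_betw_imp_inj_on inj_on_image_edges)
  then have inj: "inj_on (image f) (edge_boundary G (f -` A))" for A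
    by (rule inj_on_subset) (auto simp: edge_boundary_def)
  have image: "edge_boundary H A = image f ` edge_boundary G (f -` A)" for A
    by (auto simp: edge_boundary_def simp flip: edges)
  show thesis by (rule that) (simp add: image card_image[OF inj])
qed

lemma edges_path_graph_Suc:
  "edges (path_graph (Suc m)) = insert {m, Suc m} (edges (path_graph m))"
  by (auto simp: path_graph_def less_Suc_eq)

lemma odd_card_edge_boundary_path_graph_iff:
  "odd (card (edge_boundary (path_graph m) A)) \<longleftrightarrow> (0 \<in> A) \<noteq> (m \<in> A)"
proof (induction m)
  case 0
  then show ?case by (simp add: edge_boundary_def path_graph_def)
next
  case (Suc m)
  let ?B = "edge_boundary (path_graph m) A"
  have "finite ?B" by (simp add: edge_boundary_def finite_edges simple_graph_path_graph)
  moreover have "{m, Suc m} \<notin> ?B"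
    by (auto simp: edge_boundary_def path_graph_def doubleton_eq_iff)
  moreover have "edge_boundary (path_graph (Suc m)) A =
      (if (m \<in> A) \<noteq> (Suc m \<in> A) then insert {m, Suc m} ?B else ?B)"
    by (auto simp: edge_boundary_def edges_path_graph_Suc)
  ultimately show ?case using Suc.IH by auto
qed

lemma path_card_odd_boundary_parts_le_2:
  assumes "graph_isomorphic (path_graph m) H"
    and odd: "\<And>a. a \<in> S \<Longrightarrow> odd (card (edge_boundary H (l -` {a})))"
  shows "card S \<le> 2"
proof -
  obtain f where
    boundary: "\<And>A. card (edge_boundary H A) = card (edge_boundary (path_graph m) (f -` A))"
    using graph_isomorphic_card_edge_boundary[OF simple_graph_path_graph assms(1)] by metis
  have "S \<subseteq> {l (f 0), l (f m)}"
  proof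
    fix a assume "a \<in> S"
    then have "odd (card (edge_boundary (path_graph m) (f -` l -` {a})))"
      using odd by (simp flip: boundary)
    then show "a \<in> {l (f 0), l (f m)}" by (auto simp: odd_card_edge_boundary_path_graph_iff)
  qed
  then have "card S \<le> card {l (f 0), l (f m)}" by (intro card_mono) auto
  also have "\<dots> \<le> 2" by (simp add: card_insert_if)
  finally show ?thesis .
qed

lemma card_edge_boundary_part:
  assumes "simple_graph G" "finite T" and parts: "l ` verts G \<subseteq> T"
  shows "card (edge_boundary G (l -` {a})) = (\<Sum>b\<in>T - {a}. card {e \<in> edges G. l ` e = {a, b}})"
proof -
  have "e \<inter> l -` {a} \<noteq> {} \<and> e - l -` {a} \<noteq> {} \<longleftrightarrow> (\<exists>b\<in>T - {a}. l ` e = {a, b})"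
    if "e \<in> edges G" for e
  proof -
    obtain u v where "e = {u, v}" "u \<in> verts G" "v \<in> verts G"
      using \<open>e \<in> edges G\<close> assms(1) by (auto simp: simple_graph_def nsets_def card_2_iff)
    moreover from this have "l u \<in> T" "l v \<in> T" using parts by auto
    ultimately show ?thesis by (auto simp: doubleton_eq_iff)
  qed
  then have "edge_boundary G (l -` {a}) = (\<Union>b\<in>T - {a}. {e \<in> edges G. l ` e = {a, b}})"
    unfolding edge_boundary_def by blast
  also have "card \<dots> = (\<Sum>b\<in>T - {a}. card {e \<in> edges G. l ` e = {a, b}})"
    using assms by (intro card_UN_disjoint) (auto simp: finite_edges doubleton_eq_iff)
  finally show ?thesis .
qed

text \<open>The empty set stands for the edges inside a part, which all receive the same colour.\<close>

definition part_pair :: "('a \<Rightarrow> 'b) \<Rightarrow> 'a set \<Rightarrow> 'b set" where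
  "part_pair l e = (if card (l ` e) = 2 then l ` e else {})"

lemma part_pair_image_edges:
  assumes "simple_graph G" "l ` verts G \<subseteq> T"
  shows "part_pair l ` edges G \<subseteq> insert {} ([T]\<^bsup>2\<^esup>)"
proof (rule image_subsetI)
  fix e assume "e \<in> edges G"
  then have "l ` e \<subseteq> T" using assms by (auto simp: simple_graph_def nsets_def)
  then show "part_pair l e \<in> insert {} ([T]\<^bsup>2\<^esup>)"
    by (auto simp: part_pair_def nsets_def intro: card_ge_0_finite)
qed

lemma part_pair_eq_doubleton_iff:
  assumes "a \<noteq> b"
  shows "part_pair l e = {a, b} \<longleftrightarrow> l ` e = {a, b}"
  using assms by (auto simp: part_pair_def)

lemma color_class_comp:
  assumes "inj_on h P" "f ` edges G \<subseteq> P" "p \<in> P"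
  shows "color_class G (h \<circ> f) (h p) = {e \<in> edges G. f e = p}"
  using assms by (auto simp: color_class_def inj_on_eq_iff)

lemma balanced_iff_card_color_class_eq:
  assumes "0 < r" "card (edges G) = r * k"
  shows "balanced r G c \<longleftrightarrow> (\<forall>i<r. card (color_class G c i) = k)"
  using assms by (simp add: balanced_def)

lemma balanced_part_pair_coloring_card_edge_boundary:
  assumes "simple_graph G" "finite T" and parts: "l ` verts G \<subseteq> T"
    and h: "bij_betw h (insert {} ([T]\<^bsup>2\<^esup>)) {..<r}"
    and balanced: "balanced r G (h \<circ> part_pair l)" and size: "card (edges G) = r * k"
    and "a \<in> T"
  shows "card (edge_boundary G (l -` {a})) = (card T - 1) * k"
proof -
  have "card {e \<in> edges G. l ` e = {a, b}} = k" if "b \<in> T - {a}" for b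
  proof -
    have "a \<noteq> b" using that by blast
    have pair: "{a, b} \<in> insert {} ([T]\<^bsup>2\<^esup>)" using that \<open>a \<in> T\<close> by (auto simp: nsets_def)
    have "color_class G (h \<circ> part_pair l) (h {a, b}) = {e \<in> edges G. part_pair l e = {a, b}}"
      using bij_betw_imp_inj_on[OF h] part_pair_image_edges[OF assms(1) parts] pair
      by (rule color_class_comp)
    also have "\<dots> = {e \<in> edges G. l ` e = {a, b}}"
      using \<open>a \<noteq> b\<close> by (simp add: part_pair_eq_doubleton_iff)
    finally have "color_class G (h \<circ> part_pair l) (h {a, b}) = {e \<in> edges G. l ` e = {a, b}}" .
    moreover have "h {a, b} < r" using bij_betwE[OF h] pair by blast
    then have "card (color_class G (h \<circ> part_pair l) (h {a, b})) = k"
      using balanced balanced_iff_card_color_class_eq[OF _ size] by (metis gr_zeroI not_less_zero)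
    ultimately show ?thesis by simp
  qed
  then show ?thesis using \<open>a \<in> T\<close> by (simp add: card_edge_boundary_part[OF assms(1,2) parts])
qed

lemma no_balanced_path_part_pair_coloring:
  assumes T: "finite T" "even (card T)" "2 < card T" and "odd k"
    and parts: "l ` verts K \<subseteq> T"
    and h: "bij_betw h (insert {} ([T]\<^bsup>2\<^esup>)) {..<r}"
  shows "\<not> has_balanced_copy r K (h \<circ> part_pair l) (path_graph (r * k))"
proof
  assume "has_balanced_copy r K (h \<circ> part_pair l) (path_graph (r * k))"
  then obtain H where H: "simple_graph H" "verts H \<subseteq> verts K"
    and path: "graph_isomorphic (path_graph (r * k)) H"
    and balanced: "balanced r H (h \<circ> part_pair l)"
    by (auto simp: has_balanced_copy_def subgraph_def)
  have parts_H: "l ` verts H \<subseteq> T" using H(2) parts by blast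
  have size: "card (edges H) = r * k"
    using graph_isomorphic_card_edges[OF simple_graph_path_graph path]
    by (simp add: card_edges_path_graph)
  have "odd (card (edge_boundary H (l -` {a})))" if "a \<in> T" for a
  proof -
    have "card (edge_boundary H (l -` {a})) = (card T - 1) * k"
      using H(1) T(1) parts_H h balanced size that
      by (rule balanced_part_pair_coloring_card_edge_boundary)
    then show ?thesis using T that \<open>odd k\<close> by auto
  qed
  with path have "card T \<le> 2" by (rule path_card_odd_boundary_parts_le_2)
  then show False using T by simp
qed

lemma card_mult_le_card_color_class:
  assumes "A \<subseteq> {..<n}" "B \<subseteq> {..<n}" "A \<inter> B = {}"
    and color: "\<And>u v. u \<in> A \<Longrightarrow> v \<in> B \<Longrightarrow> c {u, v} = i"
  shows "card A * card B \<le> card (color_class (complete_graph n) c i)"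
proof -
  let ?g = "\<lambda>(u, v). {u, v}"
  have "inj_on ?g (A \<times> B)" using assms(3) by (auto simp: inj_on_def doubleton_eq_iff)
  then have "card A * card B = card (?g ` (A \<times> B))"
    by (simp add: card_image card_cartesian_product)
  also have "\<dots> \<le> card (color_class (complete_graph n) c i)"
  proof (rule card_mono)
    show "finite (color_class (complete_graph n) c i)"
      by (simp add: color_class_def finite_edges simple_graph_complete_graph)
    show "?g ` (A \<times> B) \<subseteq> color_class (complete_graph n) c i"
      using assms by (auto simp: color_class_def complete_graph_def nsets_def card_insert_if)
  qed
  finally show ?thesis .
qed

lemma card_color_class_residues_ge:
  assumes "a < t" "b < t"
    and color: "\<And>u v. u mod t = a \<Longrightarrow> v mod t = b \<Longrightarrow> c {u, v} = i"
  shows "(n div (2 * t))\<^sup>2 \<le> card (color_class (complete_graph n) c i)"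
proof -
  define q where "q = n div (2 * t)"
  define A where "A = (\<lambda>x. t * x + a) ` {..<q}"
  define B where "B = (\<lambda>y. t * y + b) ` {q..<2 * q}"
  have less: "t * x + d < t * y" if "x < y" "d < t" for x y d
  proof -
    have "t * x + d < t * Suc x" using that by simp
    also have "\<dots> \<le> t * y" using that by (intro mult_le_mono2) simp
    finally show ?thesis .
  qed
  have "2 * (t * q) \<le> n"
    using times_div_less_eq_dividend[of "2 * t" n] by (simp add: q_def mult.assoc)
  moreover have "A \<subseteq> {..<t * q}" using less \<open>a < t\<close> by (auto simp: A_def)
  moreover have "B \<subseteq> {t * q..<2 * (t * q)}"
    using less[of _ "2 * q" b] \<open>b < t\<close>
    by (auto simp: B_def mult.left_commute[of t 2] intro: trans_le_add1[OF mult_le_mono2])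
  ultimately have "A \<subseteq> {..<n}" "B \<subseteq> {..<n}" "A \<inter> B = {}" by fastforce+
  moreover have "c {u, v} = i" if "u \<in> A" "v \<in> B" for u v
    using that assms by (intro color) (auto simp: A_def B_def)
  ultimately have "card A * card B \<le> card (color_class (complete_graph n) c i)"
    by (rule card_mult_le_card_color_class)
  moreover have "card A = q" "card B = q"
    using \<open>a < t\<close> by (auto simp: A_def B_def card_image inj_on_def)
  ultimately show ?thesis by (simp add: q_def power2_eq_square)
qed

lemma card_color_class_part_pair_ge:
  assumes "2 \<le> t" and h: "bij_betw h (insert {} ([{..<t}]\<^bsup>2\<^esup>)) {..<r}" and "i < r"
  shows "(n div (2 * t))\<^sup>2 \<le>
    card (color_class (complete_graph n) (h \<circ> part_pair (\<lambda>v. v mod t)) i)"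
proof -
  obtain p where p: "p \<in> insert {} ([{..<t}]\<^bsup>2\<^esup>)" "i = h p"
    using h \<open>i < r\<close> by (metis bij_betw_iff_bijections lessThan_iff)
  have "\<exists>a<t. \<exists>b<t. part_pair (\<lambda>v. v) {a, b} = p"
  proof (cases "p = {}")
    case True
    then have "part_pair (\<lambda>v. v) {0, 0} = p" by (simp add: part_pair_def)
    then show ?thesis using \<open>2 \<le> t\<close> by (metis less_le_trans zero_less_numeral)
  next
    case False
    then obtain a b where "p = {a, b}" "a \<noteq> b" "a < t" "b < t"
      using p by (auto simp: nsets_def card_2_iff)
    moreover from this have "part_pair (\<lambda>v. v) {a, b} = p"
      by (simp add: part_pair_eq_doubleton_iff)
    ultimately show ?thesis by blast
  qed
  then obtain a b where "a < t" "b < t" "part_pair (\<lambda>v. v) {a, b} = p" by blast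
  then show ?thesis
    using p by (intro card_color_class_residues_ge[of a t b]) (auto simp: part_pair_def)
qed

lemma bal_ge:
  assumes "edge_coloring r (complete_graph n) c"
    and "\<And>i. i < r \<Longrightarrow> m \<le> card (color_class (complete_graph n) c i)"
    and "\<not> has_balanced_copy r (complete_graph n) c G"
  shows "enat m \<le> bal r n G"
  unfolding bal_def
proof (intro Inf_greatest, clarify)
  fix m'
  assume "\<forall>c. edge_coloring r (complete_graph n) c \<longrightarrow>
      (\<forall>i<r. m' < card (color_class (complete_graph n) c i)) \<longrightarrow>
      has_balanced_copy r (complete_graph n) c G"
  then obtain i where "i < r" "card (color_class (complete_graph n) c i) \<le> m'"
    using assms(1,3) by (meson not_less)
  with assms(2)[of i] show "enat m \<le> enat m'" by simp
qed

lemma bal_path_graph_ge: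
  assumes t: "even t" "2 < t" and k: "odd k"
  defines "r \<equiv> Suc (t choose 2)"
  shows "enat ((n div (2 * t))\<^sup>2) \<le> bal r n (path_graph (r * k))"
proof -
  let ?P = "insert {} ([{..<t}]\<^bsup>2\<^esup>)" and ?l = "\<lambda>v. v mod t"
  have "{} \<notin> [{..<t}]\<^bsup>2\<^esup>" by (simp add: nsets_def)
  then have "finite ?P" "card ?P = r" by (simp_all add: finite_imp_finite_nsets r_def)
  then obtain h where h: "bij_betw h ?P {..<r}"
    using ex_bij_betw_finite_nat by (metis atLeast0LessThan)
  have parts: "?l ` verts (complete_graph n) \<subseteq> {..<t}" using t by auto
  show ?thesis
  proof (rule bal_ge)
    show "edge_coloring r (complete_graph n) (h \<circ> part_pair ?l)"
      using bij_betwE[OF h] part_pair_image_edges[OF simple_graph_complete_graph parts]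
      by (fastforce simp: edge_coloring_def)
    show "(n div (2 * t))\<^sup>2 \<le> card (color_class (complete_graph n) (h \<circ> part_pair ?l) i)"
      if "i < r" for i
      using t h that by (intro card_color_class_part_pair_ge) simp_all
    show "\<not> has_balanced_copy r (complete_graph n) (h \<circ> part_pair ?l) (path_graph (r * k))"
      using t k parts h by (intro no_balanced_path_part_pair_coloring) simp_all
  qed
qed

lemma enat_bigomega_power:
  assumes "0 < d" and f: "\<And>n. enat ((n div d) ^ j) \<le> f n"
  shows "enat_bigomega f (\<lambda>n. real n ^ j)"
  unfolding enat_bigomega_def
proof (intro exI conjI)
  show "0 < (1 / (2 * real d)) ^ j" using \<open>0 < d\<close> by simp
  show "\<forall>\<^sub>F n in sequentially. ereal ((1 / (2 * real d)) ^ j * \<bar>real n ^ j\<bar>) \<le> ereal_of_enat (f n)"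
    using eventually_ge_at_top[of d]
  proof eventually_elim
    case (elim n)
    have "1 \<le> n div d" using elim \<open>0 < d\<close> by (simp add: div_greater_zero_iff Suc_le_eq)
    moreover have "\<lfloor>real n / real d\<rfloor> = int (n div d)" by (rule floor_divide_of_nat_eq)
    ultimately have "real n / real d \<le> 2 * real (n div d)" by linarith
    then have "(1 / (2 * real d) * real n) ^ j \<le> real (n div d) ^ j"
      by (intro power_mono) simp_all
    then have "ereal ((1 / (2 * real d)) ^ j * \<bar>real n ^ j\<bar>) \<le> ereal_of_enat (enat ((n div d) ^ j))"
      by (simp add: power_mult_distrib power_divide)
    also have "\<dots> \<le> ereal_of_enat (f n)" using f by (simp only: ereal_of_enat_le_iff)
    finally show ?case .
  qed
qed

lemma enat_bigomega_bal_path_graph: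
  assumes "even t" "2 < t" "odd k"
  shows "enat_bigomega (\<lambda>n. bal (Suc (t choose 2)) n (path_graph (Suc (t choose 2) * k)))
    (\<lambda>n. real n ^ 2)"
proof (rule enat_bigomega_power)
  show "0 < 2 * t" using \<open>2 < t\<close> by simp
qed (rule bal_path_graph_ge[OF assms])

theorem theorem1p8:
  fixes k :: nat
  assumes "odd k"
  shows "infinite {r. 0 < r \<and> enat_bigomega (\<lambda>n. bal r n (path_graph (r * k))) (\<lambda>n. real n ^ 2)} \<and>
         enat_bigomega (\<lambda>n. bal 7 n (path_graph (7 * k))) (\<lambda>n. real n ^ 2)"
proof
  let ?R = "{r. 0 < r \<and> enat_bigomega (\<lambda>n. bal r n (path_graph (r * k))) (\<lambda>n. real n ^ 2)}"
  show "infinite ?R"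
    unfolding infinite_nat_iff_unbounded
  proof
    fix s :: nat
    let ?r = "Suc ((2 * s + 4) choose 2)"
    have "?r \<in> ?R" using enat_bigomega_bal_path_graph[of "2 * s + 4", OF _ _ assms] by simp
    moreover have "(2 * s + 4) choose 2 = (s + 2) * (2 * s + 3)"
      by (simp add: choose_two algebra_simps)
    then have "s < ?r" by simp
    ultimately show "\<exists>r>s. r \<in> ?R" by blast
  qed
  show "enat_bigomega (\<lambda>n. bal 7 n (path_graph (7 * k))) (\<lambda>n. real n ^ 2)"
    using enat_bigomega_bal_path_graph[of 4, OF _ _ assms] by (simp add: choose_two)
qed

end
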